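(* Let $\{M_i\}_{i\in I}$ be a family of pointed metric spaces, let $M=\coprod_{i\in I}M_i$ be their metric sum, and let $Y$ be a Banach space. Then the following are equivalent: (1) $\mathrm{LipSNA}(M_i,Y)$ is dense in $\mathrm{Lip}_0(M_i,Y)$ for every $i\in I$. (2) $\mathrm{LipSNA}(M,Y)$ is dense in $\mathrm{Lip}_0(M,Y)$.
   Context: All metric spaces are complete and all Banach spaces are real. A pointed metric space is a metric space $(M,d)$ with a distinguished point $0\in M$; pointed metric spaces are taken to have at least two points, and the index set $I$ is nonempty. For a Banach space $Y$, $\mathrm{Lip}_0(M,Y)$ is the Banach space of Lipschitz maps $F\colon M\to Y$ with $F(0)=0$, with the norm $\|F\|_L=\sup\{\|F(p)-F(q)\|/d(p,q)\colon p,q\in M,\ p\neq q\}$. A map $F\in\mathrm{Lip}_0(M,Y)$ strongly attains its norm if there are $p\neq q$ in $M$ with $\|F(p)-F(q)\|/d(p,q)=\|F\|_L$; $\mathrm{LipSNA}(M,Y)$ is the set of all such maps. Density is with respect to $\|\cdot\|_L$. The (metric) sum $\coprod_{i\in I}M_i$ of a family of pointed metric spaces $(M_i,d_i)$ is the disjoint union of the $M_i$ with all base points identified to one point $0$ (the base point), with the metric $d(x,y)=d_i(x,y)$ if $x,y\in M_i$, and $d(x,y)=d_i(x,0)+d_j(0,y)$ if $x\in M_i$, $y\in M_j$, $i\neq j$. *)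

theory Defs
  imports "HOL-Analysis.Analysis"
begin

section \<open>Spaces of Lipschitz maps\<close>

text \<open>A pointed metric space is given by \<open>m :: 'a metric\<close> and a base point \<open>b \<in> mspace m\<close>. Only
  the values on \<open>mspace m\<close> matter; a map in \<open>Lip0 m b\<close> is normalised to vanish off \<open>mspace m\<close>, so
  that maps which agree on \<open>mspace m\<close> are equal and the pointwise operations restrict to it.\<close>

definition Lip0 :: "'a metric \<Rightarrow> 'a \<Rightarrow> ('a \<Rightarrow> 'y::banach) set" where
  "Lip0 m b = {F. Lipschitz_continuous_map m euclidean_metric F \<and> F b = 0 \<and>
                  (\<forall>x. x \<notin> mspace m \<longrightarrow> F x = 0)}"

definition slopes :: "'a metric \<Rightarrow> ('a \<Rightarrow> 'y::banach) \<Rightarrow> real set" where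
  "slopes m F = {norm (F p - F q) / mdist m p q | p q. p \<in> mspace m \<and> q \<in> mspace m \<and> p \<noteq> q}"

definition lip_norm :: "'a metric \<Rightarrow> ('a \<Rightarrow> 'y::banach) \<Rightarrow> real" where
  "lip_norm m F = Sup (slopes m F)"

definition strongly_attains_norm :: "'a metric \<Rightarrow> ('a \<Rightarrow> 'y::banach) \<Rightarrow> bool" where
  "strongly_attains_norm m F \<longleftrightarrow>
     (\<exists>p\<in>mspace m. \<exists>q\<in>mspace m. p \<noteq> q \<and> norm (F p - F q) / mdist m p q = lip_norm m F)"

definition LipSNA :: "'a metric \<Rightarrow> 'a \<Rightarrow> ('a \<Rightarrow> 'y::banach) set" where
  "LipSNA m b = {F \<in> Lip0 m b. strongly_attains_norm m F}"

text \<open>The case distinction only serves to make the distance nonnegative off \<open>Lip0 m b\<close>, as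
  \<^locale>\<open>Metric_space\<close> demands of a distance function; see \<open>mdist_Lip0_metric\<close> below.\<close>

definition Lip0_metric :: "'a metric \<Rightarrow> 'a \<Rightarrow> ('a \<Rightarrow> 'y::banach) metric" where
  "Lip0_metric m b =
     metric (Lip0 m b,
       \<lambda>F G. if F \<in> Lip0 m b \<and> G \<in> Lip0 m b then lip_norm m (\<lambda>x. F x - G x) else 0)"

lemma bdd_above_slopes:
  assumes "F \<in> Lip0 m b"
  shows "bdd_above (slopes m F)"
proof -
  obtain B where B: "\<And>x y. x \<in> mspace m \<Longrightarrow> y \<in> mspace m \<Longrightarrow> dist (F x) (F y) \<le> B * mdist m x y"
    using assms by (auto simp: Lip0_def Lipschitz_continuous_map_def)
  have "norm (F p - F q) / mdist m p q \<le> B"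
    if "p \<in> mspace m" "q \<in> mspace m" "p \<noteq> q" for p q
  proof -
    have "mdist m p q > 0"
      using that mdist_zero[of p m q] mdist_nonneg[of m p q] by linarith
    then show ?thesis
      using B[of p q] that by (simp add: divide_le_eq dist_norm)
  qed
  then show ?thesis
    by (auto simp: slopes_def bdd_above_def)
qed

lemma Lip0_diff:
  assumes "F \<in> Lip0 m b" "G \<in> Lip0 m b"
  shows "(\<lambda>x. F x - G x) \<in> Lip0 m b"
proof -
  obtain B where B: "\<And>x y. x \<in> mspace m \<Longrightarrow> y \<in> mspace m \<Longrightarrow> dist (F x) (F y) \<le> B * mdist m x y"
    using assms by (auto simp: Lip0_def Lipschitz_continuous_map_def)
  obtain C where C: "\<And>x y. x \<in> mspace m \<Longrightarrow> y \<in> mspace m \<Longrightarrow> dist (G x) (G y) \<le> C * mdist m x y"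
    using assms(2) unfolding Lip0_def Lipschitz_continuous_map_def mdist_euclidean_metric by blast
  have "dist (F x - G x) (F y - G y) \<le> (B + C) * mdist m x y"
    if "x \<in> mspace m" "y \<in> mspace m" for x y
    using B[OF that] C[OF that] norm_diff_triangle_ineq[of "F x" "- G x" "F y" "- G y"]
    by (simp add: dist_norm distrib_right norm_minus_commute)
  then show ?thesis
    using assms by (auto simp: Lip0_def Lipschitz_continuous_map_def)
qed

lemma slope_le_lip_norm:
  assumes "F \<in> Lip0 m b" "p \<in> mspace m" "q \<in> mspace m" "p \<noteq> q"
  shows "norm (F p - F q) / mdist m p q \<le> lip_norm m F"
  unfolding lip_norm_def
  by (rule cSup_upper[OF _ bdd_above_slopes[OF assms(1)]]) (use assms in \<open>auto simp: slopes_def\<close>)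

lemma Metric_space_Lip0:
  fixes m :: "'a metric"
  assumes b: "b \<in> mspace m" and c: "c \<in> mspace m" "c \<noteq> b"
  shows "Metric_space (Lip0 m b :: ('a \<Rightarrow> 'y::banach) set)
    (\<lambda>F G. if F \<in> Lip0 m b \<and> G \<in> Lip0 m b then lip_norm m (\<lambda>x. F x - G x) else 0)"
proof -
  let ?L = "Lip0 m b :: ('a \<Rightarrow> 'y) set"
  have ne: "slopes m F \<noteq> {}" for F :: "'a \<Rightarrow> 'y"
    using b c by (auto simp: slopes_def)
  have nn: "0 \<le> lip_norm m F" if "F \<in> ?L" for F
  proof -
    have "0 \<le> norm (F c - F b) / mdist m c b" by simp
    also have "\<dots> \<le> lip_norm m F"
      by (rule slope_le_lip_norm[OF that c(1) b c(2)])
    finally show ?thesis .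
  qed
  have comm: "lip_norm m (\<lambda>x. F x - G x) = lip_norm m (\<lambda>x. G x - F x)" for F G :: "'a \<Rightarrow> 'y"
  proof -
    have "norm (F p - G p - (F q - G q)) = norm (G p - F p - (G q - F q))" for p q
      using norm_minus_cancel[of "F p - G p - (F q - G q)"] by (simp add: algebra_simps)
    then show ?thesis
      by (simp add: lip_norm_def slopes_def)
  qed
  have zero: "lip_norm m (\<lambda>x. F x - G x) = 0 \<longleftrightarrow> F = G" if FG: "F \<in> ?L" "G \<in> ?L" for F G
  proof
    assume z: "lip_norm m (\<lambda>x. F x - G x) = 0"
    have "F x = G x" for x
    proof (cases "x \<in> mspace m \<and> x \<noteq> b")
      case True
      then have "mdist m x b > 0"
        using b mdist_zero[of x m b] mdist_nonneg[of m x b] by linarith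
      moreover have "norm ((F x - G x) - (F b - G b)) / mdist m x b \<le> 0"
        using slope_le_lip_norm[OF Lip0_diff[OF FG], of x b] True b z by auto
      ultimately have "norm ((F x - G x) - (F b - G b)) \<le> 0"
        by (simp add: divide_le_0_iff)
      then show ?thesis
        using FG by (simp add: Lip0_def)
    next
      case False
      then show ?thesis using FG by (auto simp: Lip0_def)
    qed
    then show "F = G" by blast
  next
    assume "F = G"
    moreover have "slopes m (\<lambda>x. 0::'y) = {0}"
      using b c by (auto simp: slopes_def)
    ultimately show "lip_norm m (\<lambda>x. F x - G x) = 0"
      by (simp add: lip_norm_def)
  qed
  have tri: "lip_norm m (\<lambda>x. F x - H x) \<le> lip_norm m (\<lambda>x. F x - G x) + lip_norm m (\<lambda>x. G x - H x)"
    if FGH: "F \<in> ?L" "G \<in> ?L" "H \<in> ?L" for F G H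
    unfolding lip_norm_def[of m "\<lambda>x. F x - H x"]
  proof (rule cSup_least[OF ne])
    fix s assume "s \<in> slopes m (\<lambda>x. F x - H x)"
    then obtain p q where pq: "p \<in> mspace m" "q \<in> mspace m" "p \<noteq> q"
      and s: "s = norm ((F p - H p) - (F q - H q)) / mdist m p q"
      by (auto simp: slopes_def)
    have "norm ((F p - H p) - (F q - H q)) \<le>
        norm ((F p - G p) - (F q - G q)) + norm ((G p - H p) - (G q - H q))"
      using norm_triangle_ineq[of "(F p - G p) - (F q - G q)" "(G p - H p) - (G q - H q)"]
      by (simp add: algebra_simps)
    then have "s \<le> norm ((F p - G p) - (F q - G q)) / mdist m p q
        + norm ((G p - H p) - (G q - H q)) / mdist m p q"
      unfolding s add_divide_distrib[symmetric] by (rule divide_right_mono) simp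
    also have "\<dots> \<le> lip_norm m (\<lambda>x. F x - G x) + lip_norm m (\<lambda>x. G x - H x)"
      using slope_le_lip_norm[OF Lip0_diff[OF FGH(1,2)] pq]
        slope_le_lip_norm[OF Lip0_diff[OF FGH(2,3)] pq] by linarith
    finally show "s \<le> lip_norm m (\<lambda>x. F x - G x) + lip_norm m (\<lambda>x. G x - H x)" .
  qed
  show ?thesis
  proof
    show "0 \<le> (if F \<in> ?L \<and> G \<in> ?L then lip_norm m (\<lambda>x. F x - G x) else 0)" for F G
      using nn[OF Lip0_diff] by simp
    show "(if F \<in> ?L \<and> G \<in> ?L then lip_norm m (\<lambda>x. F x - G x) else 0) =
        (if G \<in> ?L \<and> F \<in> ?L then lip_norm m (\<lambda>x. G x - F x) else 0)" for F G
      using comm[of F G] by simp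
  qed (simp_all add: zero tri)
qed

lemma mspace_Lip0_metric:
  assumes "b \<in> mspace m" "c \<in> mspace m" "c \<noteq> b"
  shows "mspace (Lip0_metric m b) = Lip0 m b"
  unfolding Lip0_metric_def by (rule Metric_space.mspace_metric[OF Metric_space_Lip0[OF assms]])

lemma mdist_Lip0_metric:
  assumes "b \<in> mspace m" "c \<in> mspace m" "c \<noteq> b" and "F \<in> Lip0 m b" "G \<in> Lip0 m b"
  shows "mdist (Lip0_metric m b) F G = lip_norm m (\<lambda>x. F x - G x)"
  unfolding Lip0_metric_def
  using assms(4,5) by (simp add: Metric_space.mdist_metric[OF Metric_space_Lip0[OF assms(1-3)]])

definition LipSNA_dense :: "'a metric \<Rightarrow> 'a \<Rightarrow> 'y::banach itself \<Rightarrow> bool" where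
  "LipSNA_dense m b Y \<longleftrightarrow>
     mtopology_of (Lip0_metric m b) closure_of LipSNA m b = (Lip0 m b :: ('a \<Rightarrow> 'y) set)"

lemma LipSNA_dense_iff:
  assumes bc: "b \<in> mspace m" "c \<in> mspace m" "c \<noteq> b"
  shows "LipSNA_dense m b TYPE('y::banach) \<longleftrightarrow>
    (\<forall>F \<in> Lip0 m b :: ('a \<Rightarrow> 'y) set. \<forall>e>0. \<exists>G \<in> LipSNA m b. lip_norm m (\<lambda>x. F x - G x) < e)"
proof -
  have "mtopology_of (Lip0_metric m b) closure_of LipSNA m b =
    {F \<in> Lip0 m b :: ('a \<Rightarrow> 'y) set. \<forall>e>0. \<exists>G \<in> LipSNA m b. G \<in> mball_of (Lip0_metric m b) F e}"
    using Metric_space.metric_closure_of[OF Metric_space_mspace_mdist, of "Lip0_metric m b" "LipSNA m b"]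
    unfolding mtopology_of_def mball_of_def mspace_Lip0_metric[OF bc] .
  moreover have "G \<in> mball_of (Lip0_metric m b) F e \<longleftrightarrow> lip_norm m (\<lambda>x. F x - G x) < e"
    if "F \<in> Lip0 m b" "G \<in> LipSNA m b" for F G :: "'a \<Rightarrow> 'y" and e
  proof -
    have "G \<in> Lip0 m b" using that(2) by (simp add: LipSNA_def)
    then show ?thesis
      using that(1) by (simp add: mspace_Lip0_metric[OF bc] mdist_Lip0_metric[OF bc])
  qed
  ultimately show ?thesis
    unfolding LipSNA_dense_def by (simp add: set_eq_iff) blast
qed



section \<open>Metric sums\<close>

text \<open>The point \<open>x\<close> of the \<open>i\<close>-th space is \<open>Some (i, x)\<close>, except that all the base points \<open>b i\<close>
  become the single point \<open>None\<close>.\<close>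

definition sum_in :: "('i \<Rightarrow> 'a) \<Rightarrow> 'i \<Rightarrow> 'a \<Rightarrow> ('i \<times> 'a) option" where
  "sum_in b i x = (if x = b i then None else Some (i, x))"

fun sum_dist :: "('i \<Rightarrow> 'a metric) \<Rightarrow> ('i \<Rightarrow> 'a) \<Rightarrow> ('i \<times> 'a) option \<Rightarrow> ('i \<times> 'a) option \<Rightarrow> real" where
  "sum_dist M b None None = 0"
| "sum_dist M b (Some (i, x)) None = mdist (M i) x (b i)"
| "sum_dist M b None (Some (j, y)) = mdist (M j) (b j) y"
| "sum_dist M b (Some (i, x)) (Some (j, y)) =
     (if i = j then mdist (M i) x y else mdist (M i) x (b i) + mdist (M j) (b j) y)"

definition metric_sum :: "'i set \<Rightarrow> ('i \<Rightarrow> 'a metric) \<Rightarrow> ('i \<Rightarrow> 'a) \<Rightarrow> ('i \<times> 'a) option metric" where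
  "metric_sum I M b = metric (\<Union>i\<in>I. sum_in b i ` mspace (M i), sum_dist M b)"

lemma Metric_space_sum:
  assumes b: "\<And>i. i \<in> I \<Longrightarrow> b i \<in> mspace (M i)"
  shows "Metric_space (\<Union>i\<in>I. sum_in b i ` mspace (M i)) (sum_dist M b)"
proof
  let ?S = "\<Union>i\<in>I. sum_in b i ` mspace (M i)"
  have S: "u \<in> ?S \<Longrightarrow> u = None \<or> (\<exists>i x. u = Some (i, x) \<and> i \<in> I \<and> x \<in> mspace (M i) \<and> x \<noteq> b i)" for u
    by (auto simp: sum_in_def split: if_splits)
  show "0 \<le> sum_dist M b u v" for u v
    by (cases "(M, b, u, v)" rule: sum_dist.cases) auto
  show "sum_dist M b u v = sum_dist M b v u" for u v
    by (cases "(M, b, u, v)" rule: sum_dist.cases) (auto simp: mdist_commute)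
  show "sum_dist M b u v = 0 \<longleftrightarrow> u = v" if "u \<in> ?S" "v \<in> ?S" for u v
  proof -
    have "mdist (M i) x (b i) + mdist (M j) (b j) y \<noteq> 0"
      if "i \<in> I" "x \<in> mspace (M i)" "x \<noteq> b i" for i x j y
      using that b mdist_zero[of x "M i" "b i"] mdist_nonneg[of "M i" x "b i"]
        mdist_nonneg[of "M j" "b j" y] by (metis add_nonneg_eq_0_iff)
    then show ?thesis
      using S[OF that(1)] S[OF that(2)] b by (auto split: if_splits)
  qed
  show "sum_dist M b u w \<le> sum_dist M b u v + sum_dist M b v w"
    if "u \<in> ?S" "v \<in> ?S" "w \<in> ?S" for u v w
  proof -
    have t: "mdist (M i) x z \<le> mdist (M i) x y + mdist (M i) y z"
      if "i \<in> I" "x \<in> mspace (M i)" "y \<in> mspace (M i)" "z \<in> mspace (M i)" for i x y z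
      using that mdist_triangle by metis
    have t0: "mdist (M i) x z \<le> mdist (M i) x (b i) + mdist (M i) (b i) z"
      if "i \<in> I" "x \<in> mspace (M i)" "z \<in> mspace (M i)" for i x z
      using that b mdist_triangle by metis
    have n: "mdist (M i) x y \<ge> 0" for i x y by simp
    have S': "i \<in> I" "x \<in> mspace (M i)" if "p \<in> ?S" "p = Some (i, x)" for p i x
      using S[OF that(1)] that(2) by auto
    consider "u = None" "w = None" | "v = None"
      | k z j y where "u = None" "v = Some (j, y)" "w = Some (k, z)"
      | i x j y where "u = Some (i, x)" "v = Some (j, y)" "w = None"
      | i x j y k z where "u = Some (i, x)" "v = Some (j, y)" "w = Some (k, z)"
      by (metis not_None_eq surj_pair)
    then show ?thesis
    proof cases
      case 1
      then show ?thesis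
        by (cases v) auto
    next
      case 2
      show ?thesis
        using S[OF that(1)] S[OF that(3)] by (elim disjE exE conjE) (auto simp: 2 t0)
    next
      case (3 k z j y)
      show ?thesis
        using 3 S'[OF that(2) 3(2)] S'[OF that(3) 3(3)] t[of j "b j" y z] b[of j]
        by (cases "j = k") auto
    next
      case (4 i x j y)
      show ?thesis
        using 4 S'[OF that(1) 4(1)] S'[OF that(2) 4(2)] t[of i x y "b i"] b[of i]
        by (cases "i = j") auto
    next
      case (5 i x j y k z)
      have mem: "i \<in> I" "x \<in> mspace (M i)" "j \<in> I" "y \<in> mspace (M j)"
          "k \<in> I" "z \<in> mspace (M k)"
        using S'[OF that(1) 5(1)] S'[OF that(2) 5(2)] S'[OF that(3) 5(3)] by simp_all
      note uvw = 5
      consider "i = j" "j = k" | "i = j" "j \<noteq> k" | "i \<noteq> j" "j = k" | "i \<noteq> j" "i = k"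
        | "i \<noteq> j" "j \<noteq> k" "i \<noteq> k" by blast
      then show ?thesis
      proof cases
        case 1
        show ?thesis unfolding uvw using 1 mem t[of i x y z] by auto
      next
        case 2
        show ?thesis unfolding uvw using 2 mem t[of i x y "b i"] b[of i] by auto
      next
        case 3
        show ?thesis unfolding uvw using 3 mem t[of j "b j" y z] b[of j] by auto
      next
        case 4
        show ?thesis unfolding uvw using 4 mem t0[of i x z]
          by simp (use n[of j y "b j"] n[of j "b j" y] in linarith)
      next
        case 5
        show ?thesis unfolding uvw using 5
          by simp
      qed
    qed
  qed
qed

lemma mspace_metric_sum:
  assumes "\<And>i. i \<in> I \<Longrightarrow> b i \<in> mspace (M i)"
  shows "mspace (metric_sum I M b) = (\<Union>i\<in>I. sum_in b i ` mspace (M i))"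
  unfolding metric_sum_def by (rule Metric_space.mspace_metric[OF Metric_space_sum[OF assms]])

lemma mdist_metric_sum:
  assumes "\<And>i. i \<in> I \<Longrightarrow> b i \<in> mspace (M i)"
  shows "mdist (metric_sum I M b) = sum_dist M b"
  unfolding metric_sum_def by (rule Metric_space.mdist_metric[OF Metric_space_sum[OF assms]])

lemma mdist_metric_sum_same:
  assumes "\<And>i. i \<in> I \<Longrightarrow> b i \<in> mspace (M i)"
    and "i \<in> I" "x \<in> mspace (M i)" "y \<in> mspace (M i)"
  shows "mdist (metric_sum I M b) (sum_in b i x) (sum_in b i y) = mdist (M i) x y"
  using assms by (simp add: mdist_metric_sum sum_in_def mdist_commute)

lemma mdist_metric_sum_different:
  assumes "\<And>i. i \<in> I \<Longrightarrow> b i \<in> mspace (M i)"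
    and "i \<in> I" "j \<in> I" "i \<noteq> j" "x \<in> mspace (M i)" "y \<in> mspace (M j)"
  shows "mdist (metric_sum I M b) (sum_in b i x) (sum_in b j y) =
    mdist (M i) x (b i) + mdist (M j) (b j) y"
proof -
  have z: "mdist (M i) (b i) (b i) = 0" "mdist (M j) (b j) (b j) = 0"
    using assms by simp_all
  show ?thesis
    using assms by (simp add: z mdist_metric_sum sum_in_def)
qed

end

theory Submission
  imports Defs
begin

text \<open>A map on the metric sum is a family of maps on the summands, and its norm is the supremum of
  their norms: across two summands the slope is a convex combination of the slopes towards the
  base point. So a map that strongly attains its norm on the sum does so inside one summand.

  For (1) implies (2), multiply a component of almost maximal norm by a factor slightly above 1, so
  that it strictly dominates the other components, and replace it by a nearby map that strongly
  attains its norm. For (2) implies (1), extend a nonzero map on one summand by 0; a nearby map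
  that strongly attains its norm has small components on all other summands, so it can only attain
  its norm on the given one.\<close>

section \<open>The Lipschitz norm\<close>

lemma Lip0I:
  assumes "\<And>p q. p \<in> mspace m \<Longrightarrow> q \<in> mspace m \<Longrightarrow> norm (F p - F q) \<le> c * mdist m p q"
    and "F b = 0" "\<And>x. x \<notin> mspace m \<Longrightarrow> F x = 0"
  shows "F \<in> Lip0 m b"
  using assms by (auto simp: Lip0_def Lipschitz_continuous_map_def dist_norm)

text \<open>The points \<open>b\<close> and \<open>c\<close> make the set of slopes nonempty; the
  supremum of an empty set of reals would be unspecified. The bound is stated as a product so that
  it also covers \<open>p = q\<close> and adds up along a path.\<close>

lemma lip_norm_le:
  assumes "b \<in> mspace m" "c \<in> mspace m" "c \<noteq> b"
    and B: "\<And>p q. p \<in> mspace m \<Longrightarrow> q \<in> mspace m \<Longrightarrow> norm (F p - F q) \<le> B * mdist m p q"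
  shows "lip_norm m F \<le> B"
  unfolding lip_norm_def
proof (rule cSup_least)
  show "slopes m F \<noteq> {}"
    using assms by (auto simp: slopes_def)
next
  fix s assume "s \<in> slopes m F"
  then obtain p q where pq: "p \<in> mspace m" "q \<in> mspace m" "p \<noteq> q"
    and s: "s = norm (F p - F q) / mdist m p q"
    by (auto simp: slopes_def)
  then have "mdist m p q > 0"
    using mdist_zero[of p m q] mdist_nonneg[of m p q] by linarith
  then show "s \<le> B"
    using B[OF pq(1,2)] by (simp add: s divide_le_eq)
qed

lemma norm_diff_le_lip_norm:
  assumes "F \<in> Lip0 m b" "p \<in> mspace m" "q \<in> mspace m"
  shows "norm (F p - F q) \<le> lip_norm m F * mdist m p q"
proof (cases "p = q")
  case True
  then have "mdist m p q = 0" using assms by simp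
  then show ?thesis by (simp add: True)
next
  case False
  then have "mdist m p q > 0"
    using assms mdist_zero[of p m q] mdist_nonneg[of m p q] by linarith
  then show ?thesis
    using slope_le_lip_norm[OF assms False] by (simp add: divide_le_eq)
qed

lemma strongly_attains_norm_iff:
  "strongly_attains_norm m F \<longleftrightarrow>
    (\<exists>p\<in>mspace m. \<exists>q\<in>mspace m. p \<noteq> q \<and> norm (F p - F q) = lip_norm m F * mdist m p q)"
proof -
  have "norm (F p - F q) / mdist m p q = lip_norm m F \<longleftrightarrow>
      norm (F p - F q) = lip_norm m F * mdist m p q"
    if "p \<in> mspace m" "q \<in> mspace m" "p \<noteq> q" for p q
    using that by (simp add: divide_eq_eq)
  then show ?thesis
    unfolding strongly_attains_norm_def by blast
qed

lemma lip_norm_nonneg: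
  assumes "b \<in> mspace m" "c \<in> mspace m" "c \<noteq> b" "F \<in> Lip0 m b"
  shows "0 \<le> lip_norm m F"
proof -
  have "0 \<le> norm (F c - F b) / mdist m c b" by simp
  also have "\<dots> \<le> lip_norm m F"
    by (rule slope_le_lip_norm[OF assms(4,2,1,3)])
  finally show ?thesis .
qed

text \<open>A map of norm 0 is constant on the space, so the pair \<open>c\<close>, \<open>b\<close>
  attains the norm. This settles the degenerate case of both implications, where scaling and strict
  gaps give nothing.\<close>

lemma LipSNA_if_lip_norm_zero:
  assumes "b \<in> mspace m" "c \<in> mspace m" "c \<noteq> b" "F \<in> Lip0 m b" "lip_norm m F = 0"
  shows "F \<in> LipSNA m b"
  using assms norm_diff_le_lip_norm[OF assms(4,2,1)]
  by (auto simp: LipSNA_def strongly_attains_norm_iff)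

lemma lip_norm_self_diff:
  assumes "b \<in> mspace m" "c \<in> mspace m" "c \<noteq> b" "F \<in> Lip0 m b"
  shows "lip_norm m (\<lambda>x. F x - F x) = 0"
  using lip_norm_le[OF assms(1-3), of "\<lambda>x. F x - F x" 0]
    lip_norm_nonneg[OF assms(1-3) Lip0_diff[OF assms(4,4)]] by simp

lemma lip_norm_triangle:
  assumes "b \<in> mspace m" "c \<in> mspace m" "c \<noteq> b" "F \<in> Lip0 m b" "G \<in> Lip0 m b"
  shows "lip_norm m F \<le> lip_norm m (\<lambda>x. F x - G x) + lip_norm m G"
proof (rule lip_norm_le[OF assms(1-3)])
  fix p q assume pq: "p \<in> mspace m" "q \<in> mspace m"
  have "norm (F p - F q) \<le> norm ((F p - G p) - (F q - G q)) + norm (G p - G q)"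
    using norm_triangle_ineq[of "(F p - G p) - (F q - G q)" "G p - G q"] by (simp add: algebra_simps)
  also have "\<dots> \<le> (lip_norm m (\<lambda>x. F x - G x) + lip_norm m G) * mdist m p q"
    using norm_diff_le_lip_norm[OF Lip0_diff[OF assms(4,5)] pq]
      norm_diff_le_lip_norm[OF assms(5) pq] by (simp add: distrib_right)
  finally show "norm (F p - F q) \<le> (lip_norm m (\<lambda>x. F x - G x) + lip_norm m G) * mdist m p q" .
qed

lemma norm_scaleR_diff_le:
  assumes "F \<in> Lip0 m b" "0 \<le> t" "p \<in> mspace m" "q \<in> mspace m"
  shows "norm (t *\<^sub>R F p - t *\<^sub>R F q) \<le> t * lip_norm m F * mdist m p q"
proof -
  have "norm (t *\<^sub>R F p - t *\<^sub>R F q) = t * norm (F p - F q)"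
    using assms(2) by (simp flip: scaleR_diff_right)
  also have "\<dots> \<le> t * (lip_norm m F * mdist m p q)"
    by (rule mult_left_mono[OF norm_diff_le_lip_norm[OF assms(1,3,4)] assms(2)])
  finally show ?thesis by (simp add: mult.assoc)
qed

lemma Lip0_scaleR:
  assumes "F \<in> Lip0 m b" "0 \<le> t"
  shows "(\<lambda>x. t *\<^sub>R F x) \<in> Lip0 m b"
  by (rule Lip0I, rule norm_scaleR_diff_le[OF assms]) (use assms in \<open>auto simp: Lip0_def\<close>)

lemma lip_norm_scaleR:
  assumes "b \<in> mspace m" "c \<in> mspace m" "c \<noteq> b" "F \<in> Lip0 m b" "0 < t"
  shows "lip_norm m (\<lambda>x. t *\<^sub>R F x) = t * lip_norm m F"
proof (rule antisym)
  have le: "lip_norm m (\<lambda>x. s *\<^sub>R G x) \<le> s * lip_norm m G" if "G \<in> Lip0 m b" "0 < s"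
    for s and G :: "'a \<Rightarrow> 'b"
    using that by (intro lip_norm_le[OF assms(1-3)] norm_scaleR_diff_le) auto
  show "lip_norm m (\<lambda>x. t *\<^sub>R F x) \<le> t * lip_norm m F"
    using assms by (intro le)
  \<comment> \<open>The reverse estimate is the first one applied to the scaled map and the factor
    \<open>inverse t\<close>.\<close>
  have "lip_norm m F \<le> inverse t * lip_norm m (\<lambda>x. t *\<^sub>R F x)"
    using le[OF Lip0_scaleR[OF assms(4)], of t "inverse t"] assms(5) by simp
  then show "t * lip_norm m F \<le> lip_norm m (\<lambda>x. t *\<^sub>R F x)"
    using assms(5) by (simp add: field_simps)
qed

section \<open>Maps on a metric sum\<close>

text \<open>The value 0 for an index outside \<open>I\<close>, where \<open>f\<close> is
  unconstrained, provides the normalisation off the space that \<open>Lip0\<close> demands.\<close>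

definition glue :: "'i set \<Rightarrow> ('i \<Rightarrow> 'a \<Rightarrow> 'y::zero) \<Rightarrow> ('i \<times> 'a) option \<Rightarrow> 'y" where
  "glue I f u = (case u of None \<Rightarrow> 0 | Some (i, x) \<Rightarrow> if i \<in> I then f i x else 0)"

locale metric_sum_family =
  fixes I :: "'i set" and M :: "'i \<Rightarrow> 'a metric" and b :: "'i \<Rightarrow> 'a"
  assumes I_nonempty: "I \<noteq> {}"
    and base: "\<And>i. i \<in> I \<Longrightarrow> b i \<in> mspace (M i)"
    and nontrivial: "\<And>i. i \<in> I \<Longrightarrow> \<exists>p\<in>mspace (M i). p \<noteq> b i"
begin

section \<open>Points and distances of the metric sum\<close>

abbreviation "S \<equiv> metric_sum I M b"

lemma mspace_S: "mspace S = (\<Union>i\<in>I. sum_in b i ` mspace (M i))"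
  using base by (rule mspace_metric_sum)

lemma mdist_S_same:
  assumes "i \<in> I" "x \<in> mspace (M i)" "y \<in> mspace (M i)"
  shows "mdist S (sum_in b i x) (sum_in b i y) = mdist (M i) x y"
  using base assms by (rule mdist_metric_sum_same)

lemma mdist_S_different:
  assumes "i \<in> I" "j \<in> I" "i \<noteq> j" "x \<in> mspace (M i)" "y \<in> mspace (M j)"
  shows "mdist S (sum_in b i x) (sum_in b j y) = mdist (M i) x (b i) + mdist (M j) (b j) y"
  using base assms by (rule mdist_metric_sum_different)

lemma sum_in_base [simp]: "sum_in b i (b i) = None"
  by (simp add: sum_in_def)

lemma sum_in_eq_iff [simp]: "sum_in b i x = sum_in b i y \<longleftrightarrow> x = y"
  by (auto simp: sum_in_def)

lemma sum_in_mspace: "i \<in> I \<Longrightarrow> x \<in> mspace (M i) \<Longrightarrow> sum_in b i x \<in> mspace S"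
  by (auto simp: mspace_S)

lemma sum_in_not_mspace: "i \<in> I \<Longrightarrow> x \<notin> mspace (M i) \<Longrightarrow> sum_in b i x \<notin> mspace S"
  using base by (auto simp: mspace_S sum_in_def split: if_splits)

lemma mspace_S_cases:
  assumes "u \<in> mspace S"
  obtains i x where "i \<in> I" "x \<in> mspace (M i)" "u = sum_in b i x"
  using assms by (auto simp: mspace_S)

lemma None_mspace: "None \<in> mspace S"
  using I_nonempty sum_in_mspace base sum_in_base by (metis ex_in_conv)

lemma S_nontrivial: "\<exists>p\<in>mspace S. p \<noteq> None"
  using I_nonempty sum_in_mspace nontrivial base sum_in_base sum_in_eq_iff by (metis ex_in_conv)

section \<open>Restriction to the summands\<close>

text \<open>The map \<open>sum_in b i\<close> is an isometric embedding that takes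
  \<open>b i\<close> to \<open>None\<close> and points off \<open>M i\<close> to points off the sum,
  so the Lipschitz bound and both normalisations are inherited.\<close>

lemma Lip0_component:
  assumes "G \<in> Lip0 S None" "i \<in> I"
  shows "G \<circ> sum_in b i \<in> Lip0 (M i) (b i)"
proof (rule Lip0I[where c = "lip_norm S G"])
  fix p q assume "p \<in> mspace (M i)" "q \<in> mspace (M i)"
  then show "norm ((G \<circ> sum_in b i) p - (G \<circ> sum_in b i) q) \<le> lip_norm S G * mdist (M i) p q"
    using norm_diff_le_lip_norm[OF assms(1), of "sum_in b i p" "sum_in b i q"] assms
    by (simp add: sum_in_mspace mdist_S_same)
qed (use assms sum_in_not_mspace in \<open>auto simp: Lip0_def\<close>)

lemma lip_norm_component_le:
  assumes "G \<in> Lip0 S None" "i \<in> I"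
  shows "lip_norm (M i) (G \<circ> sum_in b i) \<le> lip_norm S G"
proof -
  obtain c where "c \<in> mspace (M i)" "c \<noteq> b i" using nontrivial assms by blast
  then show ?thesis
    using norm_diff_le_lip_norm[OF assms(1), of "sum_in b i _" "sum_in b i _"] assms
    by (intro lip_norm_le[OF base]) (simp_all add: sum_in_mspace mdist_S_same[symmetric])
qed

text \<open>Between different summands the distance is the sum of the two distances to the base
  point, where \<open>G\<close> vanishes; adding the bounds on the two legs keeps the same constant
  \<open>c\<close>.\<close>

lemma norm_diff_le_on_sum:
  assumes "G None = 0"
    and B: "\<And>i x y. i \<in> I \<Longrightarrow> x \<in> mspace (M i) \<Longrightarrow> y \<in> mspace (M i) \<Longrightarrow>
      norm (G (sum_in b i x) - G (sum_in b i y)) \<le> c * mdist (M i) x y"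
    and "u \<in> mspace S" "v \<in> mspace S"
  shows "norm (G u - G v) \<le> c * mdist S u v"
proof -
  obtain i x where u: "i \<in> I" "x \<in> mspace (M i)" "u = sum_in b i x"
    using mspace_S_cases[OF assms(3)] .
  obtain j y where v: "j \<in> I" "y \<in> mspace (M j)" "v = sum_in b j y"
    using mspace_S_cases[OF assms(4)] .
  show ?thesis
  proof (cases "i = j")
    case True
    then show ?thesis using u v B by (simp add: mdist_S_same)
  next
    case False
    have "norm (G u - G v) \<le> norm (G u) + norm (G v)"
      by (rule norm_triangle_ineq4)
    also have "\<dots> \<le> c * mdist (M i) x (b i) + c * mdist (M j) (b j) y"
      using B[OF u(1,2) base] B[OF v(1) base v(2)] u v assms(1) by (simp add: add_mono)
    also have "\<dots> = c * mdist S u v"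
      using u v False by (simp add: mdist_S_different distrib_left)
    finally show ?thesis .
  qed
qed

text \<open>Together with \<open>lip_norm_component_le\<close> this identifies the norm on the sum
  as the supremum of the norms of the components.\<close>

lemma lip_norm_sum_le:
  assumes "G \<in> Lip0 S None" and c: "\<And>i. i \<in> I \<Longrightarrow> lip_norm (M i) (G \<circ> sum_in b i) \<le> c"
  shows "lip_norm S G \<le> c"
proof -
  have "norm (G (sum_in b i x) - G (sum_in b i y)) \<le> c * mdist (M i) x y"
    if "i \<in> I" "x \<in> mspace (M i)" "y \<in> mspace (M i)" for i x y
    using norm_diff_le_lip_norm[OF Lip0_component[OF assms(1)] that(2,3)] that(1)
      mult_right_mono[OF c[OF that(1)] mdist_nonneg[of "M i" x y]] by simp
  then have "norm (G u - G v) \<le> c * mdist S u v" if "u \<in> mspace S" "v \<in> mspace S" for u v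
    using that assms(1) by (intro norm_diff_le_on_sum) (auto simp: Lip0_def)
  then show ?thesis
    using S_nontrivial lip_norm_le[OF None_mspace] by blast
qed

section \<open>Gluing maps on the summands\<close>

lemma glue_component:
  assumes "i \<in> I" "f i \<in> Lip0 (M i) (b i)"
  shows "glue I f \<circ> sum_in b i = f i"
  using assms by (auto simp: fun_eq_iff glue_def sum_in_def Lip0_def)

text \<open>The common bound \<open>c\<close> serves as Lipschitz constant of the glued map; for
  infinite \<open>I\<close> the norms of the single components could be unbounded.\<close>

lemma Lip0_glue:
  assumes f: "\<And>i. i \<in> I \<Longrightarrow> f i \<in> Lip0 (M i) (b i)"
    and c: "\<And>i. i \<in> I \<Longrightarrow> lip_norm (M i) (f i) \<le> c"
  shows "glue I f \<in> Lip0 S None"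
proof (rule Lip0I)
  fix u v assume uv: "u \<in> mspace S" "v \<in> mspace S"
  show "norm (glue I f u - glue I f v) \<le> c * mdist S u v"
  proof (rule norm_diff_le_on_sum[OF _ _ uv])
    fix i x y assume i: "i \<in> I" and xy: "x \<in> mspace (M i)" "y \<in> mspace (M i)"
    have "glue I f (sum_in b i z) = f i z" for z
      using fun_cong[OF glue_component[of i f], of z] f i by simp
    then show "norm (glue I f (sum_in b i x) - glue I f (sum_in b i y)) \<le> c * mdist (M i) x y"
      using norm_diff_le_lip_norm[OF f[OF i] xy]
        mult_right_mono[OF c[OF i] mdist_nonneg[of "M i" x y]] by simp
  qed (simp add: glue_def)
next
  fix u assume "u \<notin> mspace S"
  then show "glue I f u = 0"
  proof (cases u)
    case (Some ix)
    obtain i x where ix: "u = Some (i, x)" using Some by (cases ix) auto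
    \<comment> \<open>With an index in \<open>I\<close>, a point off the sum is either
      \<open>Some (i, b i)\<close>, since the base point is represented by \<open>None\<close>, or
      has \<open>x\<close> off \<open>M i\<close>. In both cases the normalisation of
      \<open>f i\<close> gives 0.\<close>
    have "f i x = 0" if "i \<in> I"
    proof (cases "x = b i")
      case False
      then have "x \<notin> mspace (M i)"
        using \<open>u \<notin> mspace S\<close> sum_in_mspace[OF that, of x] ix by (auto simp: sum_in_def)
      then show ?thesis using f[OF that] by (simp add: Lip0_def)
    qed (use f[OF that] in \<open>simp add: Lip0_def\<close>)
    then show ?thesis by (simp add: ix glue_def)
  qed (simp add: glue_def)
qed (simp add: glue_def)

section \<open>Strong attainment on the sum\<close>

text \<open>If the attaining points lie in different summands, equality holds in the estimate
  through the base point, so each leg of positive length has maximal slope and lies in one summand.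
  The equality of norms later reveals which summand it is.\<close>

lemma LipSNA_component:
  assumes "G \<in> LipSNA S None"
  obtains i where "i \<in> I" "G \<circ> sum_in b i \<in> LipSNA (M i) (b i)"
    "lip_norm (M i) (G \<circ> sum_in b i) = lip_norm S G"
proof -
  note result = that
  let ?L = "lip_norm S G"
  have G: "G \<in> Lip0 S None" and G0: "G None = 0"
    using assms by (auto simp: LipSNA_def Lip0_def)
  \<comment> \<open>A lower bound suffices: it squeezes the component norm between \<open>?L\<close>
    and \<open>?L\<close>, and then the pair \<open>x\<close>, \<open>y\<close> attains it.\<close>
  have main: thesis if i: "i \<in> I" and xy: "x \<in> mspace (M i)" "y \<in> mspace (M i)" "x \<noteq> y"
    and att: "?L * mdist (M i) x y \<le> norm (G (sum_in b i x) - G (sum_in b i y))" for i x y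
  proof -
    let ?c = "lip_norm (M i) (G \<circ> sum_in b i)"
    have le: "norm (G (sum_in b i x) - G (sum_in b i y)) \<le> ?c * mdist (M i) x y"
      using norm_diff_le_lip_norm[OF Lip0_component[OF G i] xy(1,2)] by simp
    have "mdist (M i) x y > 0"
      using xy mdist_zero[of x "M i" y] mdist_nonneg[of "M i" x y] by linarith
    then have "?L \<le> ?c"
      using order_trans[OF att le] by simp
    then have eq: "?c = ?L"
      using lip_norm_component_le[OF G i] by simp
    then have "strongly_attains_norm (M i) (G \<circ> sum_in b i)"
      unfolding strongly_attains_norm_iff using xy att le by (auto intro!: bexI)
    then show thesis
      using result[OF i _ eq] Lip0_component[OF G i] by (simp add: LipSNA_def)
  qed
  obtain u v where uv: "u \<in> mspace S" "v \<in> mspace S" "u \<noteq> v"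
    and att: "norm (G u - G v) = ?L * mdist S u v"
    using assms by (auto simp: LipSNA_def strongly_attains_norm_iff)
  obtain i x where u: "i \<in> I" "x \<in> mspace (M i)" "u = sum_in b i x"
    using mspace_S_cases[OF uv(1)] .
  obtain j y where v: "j \<in> I" "y \<in> mspace (M j)" "v = sum_in b j y"
    using mspace_S_cases[OF uv(2)] .
  show thesis
  proof (cases "i = j")
    case True
    then show thesis
      using main[of i x y] u v uv(3) att by (simp add: mdist_S_same)
  next
    case False
    have bound: "norm (G (sum_in b k z)) \<le> ?L * mdist (M k) z (b k)"
      if "k \<in> I" "z \<in> mspace (M k)" for k z
      using norm_diff_le_lip_norm[OF G sum_in_mspace[OF that] None_mspace]
        mdist_S_same[OF that base[OF that(1)]] G0 by simp
    \<comment> \<open>Since \<open>bound\<close> limits each term on the right by the corresponding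
      one on the left, this inequality makes both bounds equalities.\<close>
    have sum: "?L * mdist (M i) x (b i) + ?L * mdist (M j) y (b j) \<le> norm (G u) + norm (G v)"
      using att u v False norm_triangle_ineq4[of "G u" "G v"]
      by (simp add: mdist_S_different distrib_left mdist_commute)
    show thesis
    \<comment> \<open>As \<open>u\<close> and \<open>v\<close> differ, they are not both the base
      point; the one that is not gives an attaining pair with the base point of its own
      summand.\<close>
    proof (cases "x = b i")
      case True
      then have "y \<noteq> b j" using uv(3) u v by auto
      moreover have "?L * mdist (M j) y (b j) \<le> norm (G v)"
        using sum bound[OF u(1,2)] u by simp
      ultimately show thesis
        using main[OF v(1,2) base[OF v(1)]] v(3) G0 by simp
    next
      case False
      moreover have "?L * mdist (M i) x (b i) \<le> norm (G u)"
        using sum bound[OF v(1,2)] v by simp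
      ultimately show thesis
        using main[OF u(1,2) base[OF u(1)]] u(3) G0 by simp
    qed
  qed
qed

text \<open>A component of largest norm has the norm of the whole map, and the isometric embedding
  carries its attaining pair into the sum.\<close>

lemma LipSNA_sumI:
  assumes G: "G \<in> Lip0 S None" and i: "i \<in> I" "G \<circ> sum_in b i \<in> LipSNA (M i) (b i)"
    and dom: "\<And>j. j \<in> I \<Longrightarrow> lip_norm (M j) (G \<circ> sum_in b j) \<le> lip_norm (M i) (G \<circ> sum_in b i)"
  shows "G \<in> LipSNA S None"
proof -
  have eq: "lip_norm S G = lip_norm (M i) (G \<circ> sum_in b i)"
    using lip_norm_sum_le[OF G dom] lip_norm_component_le[OF G i(1)] by simp
  obtain x y where "x \<in> mspace (M i)" "y \<in> mspace (M i)" "x \<noteq> y"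
    "norm (G (sum_in b i x) - G (sum_in b i y)) = lip_norm S G * mdist (M i) x y"
    using i(2) eq by (auto simp: LipSNA_def strongly_attains_norm_iff)
  then have "strongly_attains_norm S G"
    unfolding strongly_attains_norm_iff using i(1)
    by (intro bexI[of _ "sum_in b i x"] bexI[of _ "sum_in b i y"])
      (auto simp: mdist_S_same sum_in_mspace)
  then show ?thesis
    using G by (simp add: LipSNA_def)
qed

section \<open>Transfer of density\<close>

lemma LipSNA_dense_component_iff:
  assumes "i \<in> I"
  shows "LipSNA_dense (M i) (b i) TYPE('y::banach) \<longleftrightarrow>
    (\<forall>F \<in> Lip0 (M i) (b i) :: ('a \<Rightarrow> 'y) set. \<forall>e>0. \<exists>G \<in> LipSNA (M i) (b i).
      lip_norm (M i) (\<lambda>x. F x - G x) < e)"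
  using nontrivial[OF assms] LipSNA_dense_iff[OF base[OF assms]] by blast

lemma LipSNA_dense_sum_iff:
  "LipSNA_dense S None TYPE('y::banach) \<longleftrightarrow>
    (\<forall>F \<in> Lip0 S None :: (('i \<times> 'a) option \<Rightarrow> 'y) set. \<forall>e>0. \<exists>G \<in> LipSNA S None.
      lip_norm S (\<lambda>x. F x - G x) < e)"
  using S_nontrivial LipSNA_dense_iff[OF None_mspace] by blast

lemma LipSNA_dense_sum:
  assumes dense: "\<And>i. i \<in> I \<Longrightarrow> LipSNA_dense (M i) (b i) TYPE('y::banach)"
  shows "LipSNA_dense S None TYPE('y)"
  unfolding LipSNA_dense_sum_iff
proof (intro ballI allI impI)
  fix F :: "('i \<times> 'a) option \<Rightarrow> 'y" and e :: real
  assume F: "F \<in> Lip0 S None" and e: "e > 0"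
  let ?L = "lip_norm S F"
  obtain c where c: "c \<in> mspace S" "c \<noteq> None" using S_nontrivial by blast
  show "\<exists>G\<in>LipSNA S None. lip_norm S (\<lambda>x. F x - G x) < e"
  proof (cases "?L = 0")
    case True
    then show ?thesis
      using LipSNA_if_lip_norm_zero[OF None_mspace c F] lip_norm_self_diff[OF None_mspace c F] e
      by (intro bexI[of _ F]) simp_all
  next
    case False
    then have L: "?L > 0"
      using lip_norm_nonneg[OF None_mspace c F] by simp
    \<comment> \<open>Scaling a component of \<open>F\<close> by \<open>1 + t\<close> moves it by at
      most \<open>t * ?L\<close>, a third of the tolerance.\<close>
    define t where "t = e / (3 * ?L)"
    have t: "t > 0" "t * ?L = e / 3" using e L by (simp_all add: t_def)
    \<comment> \<open>The norm \<open>?L\<close> is the supremum of the component norms, and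
      \<open>?L / (1 + t)\<close> lies strictly below it. The threshold is chosen so that scaling by
      \<open>1 + t\<close> lifts this component above \<open>?L\<close>.\<close>
    have "\<exists>i\<in>I. lip_norm (M i) (F \<circ> sum_in b i) > ?L / (1 + t)"
    proof (rule ccontr)
      assume "\<not> ?thesis"
      then have "?L \<le> ?L / (1 + t)"
        by (intro lip_norm_sum_le[OF F]) (simp add: not_less)
      then show False using mult_pos_pos[OF t(1) L] t(1) by (simp add: field_simps)
    qed
    then obtain i where i: "i \<in> I" and big: "lip_norm (M i) (F \<circ> sum_in b i) > ?L / (1 + t)"
      by blast
    let ?Fi = "F \<circ> sum_in b i"
    let ?N = "lip_norm (M i) ?Fi"
    let ?H = "\<lambda>x. (1 + t) *\<^sub>R ?Fi x"
    obtain p where p: "p \<in> mspace (M i)" "p \<noteq> b i" using nontrivial[OF i] by blast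
    note ne = base[OF i] p
    have Fi: "?Fi \<in> Lip0 (M i) (b i)" by (rule Lip0_component[OF F i])
    have H: "?H \<in> Lip0 (M i) (b i)" using t by (intro Lip0_scaleR[OF Fi]) simp
    have nH: "lip_norm (M i) ?H = (1 + t) * ?N" using t by (intro lip_norm_scaleR[OF ne Fi]) simp
    have gap: "(1 + t) * ?N > ?L" using big t by (simp add: field_simps)
    \<comment> \<open>The first bound keeps \<open>g\<close> within a third of the tolerance from
      \<open>?H\<close>; the second leaves the norm of \<open>g\<close> at least \<open>?L\<close>,
      hence at least that of every component of \<open>F\<close>.\<close>
    define d where "d = min (e / 3) ((1 + t) * ?N - ?L)"
    have d: "d > 0" using e gap by (simp add: d_def)
    have d_e: "d \<le> e / 3" unfolding d_def by (rule min.cobounded1)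
    have d_gap: "d \<le> (1 + t) * ?N - ?L" unfolding d_def by (rule min.cobounded2)
    obtain g where g: "g \<in> LipSNA (M i) (b i)" and gd: "lip_norm (M i) (\<lambda>x. ?H x - g x) < d"
      using dense[OF i, unfolded LipSNA_dense_component_iff[OF i], THEN bspec, OF H] d by blast
    have gL: "g \<in> Lip0 (M i) (b i)" using g by (simp add: LipSNA_def)
    have ng: "?L \<le> lip_norm (M i) g"
      using lip_norm_triangle[OF ne H gL] nH gd d_gap by linarith
    \<comment> \<open>One third comes from approximating \<open>?H\<close> by \<open>g\<close>, one
      from the scaling. The last third is kept because the passage to the sum yields only a weak
      inequality.\<close>
    have close: "lip_norm (M i) (\<lambda>x. ?Fi x - g x) \<le> 2 * e / 3"
    proof (rule lip_norm_le[OF ne])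
      fix x y assume xy: "x \<in> mspace (M i)" "y \<in> mspace (M i)"
      have "(?Fi x - g x) - (?Fi y - g y)
          = ((?H x - g x) - (?H y - g y)) - (t *\<^sub>R ?Fi x - t *\<^sub>R ?Fi y)"
        by (simp add: algebra_simps)
      then have "norm ((?Fi x - g x) - (?Fi y - g y))
          \<le> norm ((?H x - g x) - (?H y - g y)) + norm (t *\<^sub>R ?Fi x - t *\<^sub>R ?Fi y)"
        by (metis norm_triangle_ineq4)
      also have "\<dots> \<le> lip_norm (M i) (\<lambda>x. ?H x - g x) * mdist (M i) x y + t * ?N * mdist (M i) x y"
        using norm_diff_le_lip_norm[OF Lip0_diff[OF H gL] xy]
          norm_scaleR_diff_le[OF Fi less_imp_le[OF t(1)] xy] by (rule add_mono)
      also have "\<dots> \<le> (e / 3) * mdist (M i) x y + (e / 3) * mdist (M i) x y"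
        using gd d_e mult_left_mono[OF lip_norm_component_le[OF F i], of t] t
        by (intro add_mono mult_right_mono) auto
      finally show "norm ((?Fi x - g x) - (?Fi y - g y)) \<le> 2 * e / 3 * mdist (M i) x y"
        by simp
    qed
    \<comment> \<open>Only the component \<open>i\<close> changes, so all other components of the
      difference to \<open>F\<close> vanish.\<close>
    define f where "f j = (if j = i then g else F \<circ> sum_in b j)" for j
    have f: "f j \<in> Lip0 (M j) (b j)" if "j \<in> I" for j
      using that gL Lip0_component[OF F] by (simp add: f_def)
    have fle: "lip_norm (M j) (f j) \<le> lip_norm (M i) g" if "j \<in> I" for j
      using lip_norm_component_le[OF F that] ng by (simp add: f_def)
    let ?G = "glue I f"
    have G: "?G \<in> Lip0 S None" by (rule Lip0_glue[OF f fle])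
    have comp: "?G \<circ> sum_in b j = f j" if "j \<in> I" for j
      using that f by (intro glue_component)
    have fi: "f i = g" by (simp add: f_def)
    have SNA: "?G \<in> LipSNA S None"
      using G i g fle by (intro LipSNA_sumI[OF G i]) (simp_all add: comp fi)
    have "lip_norm S (\<lambda>u. F u - ?G u) \<le> 2 * e / 3"
    proof (rule lip_norm_sum_le[OF Lip0_diff[OF F G]])
      fix j assume j: "j \<in> I"
      obtain q where q: "q \<in> mspace (M j)" "q \<noteq> b j" using nontrivial[OF j] by blast
      have eq: "(\<lambda>u. F u - ?G u) \<circ> sum_in b j = (\<lambda>x. (F \<circ> sum_in b j) x - f j x)"
        using comp[OF j] by (auto simp: fun_eq_iff)
      show "lip_norm (M j) ((\<lambda>u. F u - ?G u) \<circ> sum_in b j) \<le> 2 * e / 3"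
      proof (cases "j = i")
        case True
        then show ?thesis using close unfolding eq by (simp add: fi)
      next
        case False
        then show ?thesis
          using lip_norm_self_diff[OF base[OF j] q Lip0_component[OF F j]] e
          unfolding eq by (simp add: f_def)
      qed
    qed
    then show ?thesis using SNA e by (intro bexI[of _ ?G]) auto
  qed
qed

lemma LipSNA_dense_component:
  assumes dense: "LipSNA_dense S None TYPE('y::banach)" and i: "i \<in> I"
  shows "LipSNA_dense (M i) (b i) TYPE('y)"
  unfolding LipSNA_dense_component_iff[OF i]
proof (intro ballI allI impI)
  fix F :: "'a \<Rightarrow> 'y" and e :: real
  assume F: "F \<in> Lip0 (M i) (b i)" and e: "e > 0"
  let ?L = "lip_norm (M i) F"
  obtain p where p: "p \<in> mspace (M i)" "p \<noteq> b i" using nontrivial[OF i] by blast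
  note ne = base[OF i] p
  show "\<exists>G\<in>LipSNA (M i) (b i). lip_norm (M i) (\<lambda>x. F x - G x) < e"
  proof (cases "?L = 0")
    case True
    then show ?thesis
      using LipSNA_if_lip_norm_zero[OF ne F] lip_norm_self_diff[OF ne F] e
      by (intro bexI[of _ F]) simp_all
  next
    case False
    then have L: "?L > 0"
      using lip_norm_nonneg[OF ne F] by simp
    \<comment> \<open>With \<open>d\<close> at most half of \<open>?L\<close>, a map within
      \<open>d\<close> of the extension has norm above \<open>?L - d\<close>, which is at least
      \<open>d\<close>.\<close>
    define d where "d = min e (?L / 2)"
    have d: "d > 0" "d \<le> e" "d \<le> ?L / 2" using e L by (auto simp: d_def)
    \<comment> \<open>The family whose gluing extends \<open>F\<close> by 0 to the other
      summands.\<close>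
    define f where "f j = (if j = i then F else (\<lambda>x. 0))" for j
    have f: "f j \<in> Lip0 (M j) (b j)" for j
      using F by (auto simp: f_def intro: Lip0I[where c = 0])
    have fle: "lip_norm (M j) (f j) \<le> ?L" if j: "j \<in> I" for j
    proof (cases "j = i")
      case False
      obtain q where q: "q \<in> mspace (M j)" "q \<noteq> b j" using nontrivial[OF j] by blast
      show ?thesis
        using False L by (intro lip_norm_le[OF base[OF j] q]) (simp add: f_def)
    qed (simp add: f_def)
    let ?F = "glue I f"
    have FS: "?F \<in> Lip0 S None" by (rule Lip0_glue[OF f fle])
    obtain G where G: "G \<in> LipSNA S None" and close: "lip_norm S (\<lambda>u. ?F u - G u) < d"
      using dense FS d(1) unfolding LipSNA_dense_sum_iff by blast
    have GL: "G \<in> Lip0 S None" using G by (simp add: LipSNA_def)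
    have closej: "lip_norm (M j) (\<lambda>x. f j x - (G \<circ> sum_in b j) x) < d" if j: "j \<in> I" for j
    proof -
      have "(\<lambda>u. ?F u - G u) \<circ> sum_in b j = (\<lambda>x. f j x - (G \<circ> sum_in b j) x)"
        using glue_component[of j f, OF j f] by (auto simp: fun_eq_iff)
      then show ?thesis
        using lip_norm_component_le[OF Lip0_diff[OF FS GL] j] close by simp
    qed
    obtain j where j: "j \<in> I" and SNA: "G \<circ> sum_in b j \<in> LipSNA (M j) (b j)"
      and nj: "lip_norm (M j) (G \<circ> sum_in b j) = lip_norm S G"
      using LipSNA_component[OF G] .
    have "?L < d + lip_norm S G"
      using lip_norm_triangle[OF ne F Lip0_component[OF GL i]] closej[OF i]
        lip_norm_component_le[OF GL i] by (simp add: f_def)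
    have "j = i"
    proof (rule ccontr)
      assume "j \<noteq> i"
      \<comment> \<open>Off the summand \<open>i\<close> the extension is 0, so this component of
        \<open>G\<close> is itself the error and has norm below \<open>d\<close>. Yet it has the
        norm of \<open>G\<close>, which exceeds \<open>?L - d\<close>.\<close>
      have "lip_norm (M j) (G \<circ> sum_in b j) = lip_norm (M j) (\<lambda>x. f j x - (G \<circ> sum_in b j) x)"
        using \<open>j \<noteq> i\<close> by (simp add: f_def lip_norm_def slopes_def norm_minus_commute)
      then show False
        using closej[OF j] nj d(3) \<open>?L < d + lip_norm S G\<close> by simp
    qed
    then show ?thesis
      using SNA closej[OF i] d(2) by (intro bexI[of _ "G \<circ> sum_in b i"]) (auto simp: f_def)
  qed
qed

end

theorem theorem2p5:
  fixes I :: "'i set" and M :: "'i \<Rightarrow> 'a metric" and b :: "'i \<Rightarrow> 'a"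
  assumes "I \<noteq> {}"
    and "\<And>i. i \<in> I \<Longrightarrow> mcomplete_of (M i)"
    and "\<And>i. i \<in> I \<Longrightarrow> b i \<in> mspace (M i)"
    and "\<And>i. i \<in> I \<Longrightarrow> \<exists>p\<in>mspace (M i). p \<noteq> b i"
  shows "(\<forall>i\<in>I. LipSNA_dense (M i) (b i) TYPE('y::banach)) \<longleftrightarrow>
         LipSNA_dense (metric_sum I M b) None TYPE('y)"
proof -
  interpret metric_sum_family I M b
    by unfold_locales (fact assms(1,3,4))+
  show ?thesis
    using LipSNA_dense_sum LipSNA_dense_component by blast
qed

end
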